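(* Let $\{a_n\}_{n\geq 0}$ and $\{b_n\}_{n\geq 0}$ be two sequences with ordinary generating functions $A(x)=\sum_{n\geq0}a_nx^n$ and $B(x)=\sum_{n\geq0}b_nx^n$, and let $\mu$ be the first-order differential operator $\mu(f)=\frac{d}{dx}(x\cdot f)$. Then for any positive integer $m$, $$\sum_{n\geq 0}\left[\sum_{k=0}^n \binom{n}{k}^{-m}a_kb_{n-k}\right]x^n=\mu^m\left[\int_0^1\!\!\int_0^1\!\!\cdots\!\int_0^1 A(x\,t_1t_2\cdots t_m)\,B\big((1-t_1)(1-t_2)\cdots(1-t_m)\,x\big)\,dt_1\,dt_2\cdots dt_m\right],$$ where there are $m$ integrals.
   Context: The identity is between power series in $x$: the multiple integral is understood as the power series in $x$ obtained by integrating term by term, coefficient by coefficient. *)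

theory Defs
  imports "HOL-Analysis.Analysis" "HOL-Computational_Algebra.Formal_Power_Series"
begin

unbundle fps_syntax

text \<open>
  Generating functions are formal power series. The scalars range over a complete real
  normed field, so both real and complex sequences are covered.
\<close>

definition mu :: "'a::field_char_0 fps \<Rightarrow> 'a fps" where
  "mu f = fps_deriv (fps_X * f)"

text \<open>
  The iterated integral of \<open>F t\<^sub>1 \<dots> t\<^sub>m\<close> over the unit cube, with \<open>t\<^sub>1\<close> innermost and \<open>t\<^sub>m\<close>
  outermost. The variables are passed as a function \<open>t :: nat \<Rightarrow> real\<close>, of which only the
  values at \<open>1, \<dots>, m\<close> are meant to be used; the remaining values are set to \<open>0\<close>.
\<close>

primrec cube_integral :: "nat \<Rightarrow> ((nat \<Rightarrow> real) \<Rightarrow> 'a::banach) \<Rightarrow> 'a" where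
  "cube_integral 0 F = F (\<lambda>_. 0)"
| "cube_integral (Suc m) F = integral {0..1} (\<lambda>s. cube_integral m (\<lambda>t. F (t(Suc m := s))))"

text \<open>
  Integration of a family of power series coefficient by coefficient. For the integrands of
  interest every coefficient is a polynomial in \<open>t\<^sub>1, \<dots>, t\<^sub>m\<close>, so all integrals exist.
\<close>

definition fps_cube_integral :: "nat \<Rightarrow> ((nat \<Rightarrow> real) \<Rightarrow> 'a::banach fps) \<Rightarrow> 'a fps" where
  "fps_cube_integral m F = Abs_fps (\<lambda>n. cube_integral m (\<lambda>t. F t $ n))"

text \<open>The formal power series \<open>A(c x)\<close> for a real number \<open>c\<close>.\<close>

definition fps_scale_arg :: "real \<Rightarrow> 'a::real_normed_field fps \<Rightarrow> 'a fps" where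
  "fps_scale_arg c A = fps_compose A (fps_const (of_real c) * fps_X)"

end

theory Submission imports Defs begin

text \<open>
  The coefficient of \<open>x\<^sup>n\<close> in the integrand is a sum over \<open>k\<close> of terms
  \<open>a\<^sub>k b\<^bsub>n-k\<^esub> \<Prod>\<^sub>i t\<^sub>i\<^sup>k (1 - t\<^sub>i)\<^bsup>n-k\<^esup>\<close>, whose integral factors into \<open>m\<close> copies of the Beta
  integral \<open>1 / ((n + 1) (n choose k))\<close>. Since \<open>\<mu>\<close> multiplies the coefficient of \<open>x\<^sup>n\<close> by
  \<open>n + 1\<close>, its \<open>m\<close>-th power cancels the factor \<open>(n + 1)\<^sup>m\<close>.
\<close>

lemma mu_nth: "mu f $ n = of_nat (Suc n) * f $ n"
  by (simp add: mu_def algebra_simps)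

lemma mu_funpow_nth: "(mu ^^ m) f $ n = of_nat (Suc n) ^ m * f $ n"
  by (induction m) (simp_all add: mu_nth del: of_nat_Suc)

lemma fps_scale_arg_nth: "fps_scale_arg c A $ n = of_real c ^ n * A $ n"
  by (simp add: fps_scale_arg_def fps_compose_linear)

lemma Beta_nat: "Beta (real p + 1) (real q + 1) = 1 / (real (p + q + 1) * real ((p + q) choose p))"
proof -
  have G: "Gamma (real j + 1) = fact j" for j
    using Gamma_fact[of j, where 'a = real] by (simp add: add.commute)
  have "Gamma (real p + 1 + (real q + 1)) = fact (p + q + 1)"
    using G[of "p + q + 1"] by (simp add: algebra_simps)
  then have "Beta (real p + 1) (real q + 1) = fact p * fact q / fact (p + q + 1)"
    by (simp add: Beta_def G)
  then show ?thesis
    by (simp add: binomial_fact)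
qed

lemma has_integral_power_mult_power_Beta:
  "((\<lambda>s::real. s ^ p * (1 - s) ^ q) has_integral
     1 / (real (p + q + 1) * real ((p + q) choose p))) {0..1}"
proof -
  have "((\<lambda>s. s powr (real p + 1 - 1) * (1 - s) powr (real q + 1 - 1)) has_integral
      Beta (real p + 1) (real q + 1)) {0..1}"
    by (rule has_integral_Beta_real) auto
  \<comment> \<open>\<open>powr\<close> and \<open>^\<close> agree on positive bases, but
    \<open>0 powr 0 = 0\<close> while \<open>0 ^ 0 = 1\<close>, so the integrands can differ only at
    the endpoints.\<close>
  then have "((\<lambda>s::real. s ^ p * (1 - s) ^ q) has_integral Beta (real p + 1) (real q + 1)) {0..1}"
    by (rule has_integral_spike_finite[of "{0, 1}", rotated 2]) (auto simp: powr_realpow)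
  then show ?thesis
    by (simp only: Beta_nat)
qed

text \<open>Induction on \<open>m\<close> with the whole sum carried along, so linearity is used
  only for the one-variable integral over the outermost variable. For fixed \<open>s\<close>, the
  factor \<open>g k s\<close> is absorbed into the coefficient \<open>c k\<close>, which is why
  \<open>c\<close> stays arbitrary.\<close>

lemma cube_integral_sum_prod:
  fixes c :: "'b \<Rightarrow> 'a::{banach, real_normed_field}" and g :: "'b \<Rightarrow> real \<Rightarrow> real"
  assumes "finite K" and g: "\<And>k. k \<in> K \<Longrightarrow> (g k has_integral I k) {0..1}"
  shows "cube_integral m (\<lambda>t. \<Sum>k\<in>K. c k * of_real (\<Prod>i=1..m. g k (t i))) =
    (\<Sum>k\<in>K. c k * of_real (I k ^ m))"
proof (induction m arbitrary: c)
  case 0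
  show ?case by simp
next
  case (Suc m)
  have "cube_integral m (\<lambda>t. \<Sum>k\<in>K. c k * of_real (\<Prod>i=1..Suc m. g k ((t(Suc m := s)) i))) =
      (\<Sum>k\<in>K. c k * of_real (I k ^ m) * of_real (g k s))" for s
  proof -
    \<comment> \<open>The update changes only index \<open>Suc m\<close>, so exactly one factor
      depends on \<open>s\<close>.\<close>
    have "(\<Prod>i=1..Suc m. g k ((t(Suc m := s)) i)) = g k s * (\<Prod>i=1..m. g k (t i))" for k t
      by (simp add: mult.commute)
    then show ?thesis
      using Suc.IH[of "\<lambda>k. c k * of_real (g k s)"] by (simp add: mult_ac)
  qed
  moreover have "((\<lambda>s. \<Sum>k\<in>K. c k * of_real (I k ^ m) * of_real (g k s)) has_integral
      (\<Sum>k\<in>K. c k * of_real (I k ^ m) * of_real (I k))) {0..1}"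
    by (intro has_integral_sum has_integral_mult_right has_integral_of_real g assms)
  ultimately show ?case
    by (simp add: integral_unique mult_ac)
qed

theorem theorem2:
  fixes a b :: "nat \<Rightarrow> 'a::{banach, real_normed_field}" and m :: nat
  assumes "m \<ge> 1"
  shows "Abs_fps (\<lambda>n. \<Sum>k=0..n. of_nat (n choose k) powi (- int m) * a k * b (n - k)) =
    (mu ^^ m) (fps_cube_integral m (\<lambda>t.
      fps_scale_arg (\<Prod>i=1..m. t i) (Abs_fps a) *
      fps_scale_arg (\<Prod>i=1..m. 1 - t i) (Abs_fps b)))"
proof (rule fps_ext)
  fix n
  let ?F = "\<lambda>t. fps_scale_arg (\<Prod>i=1..m. t i) (Abs_fps a) *
      fps_scale_arg (\<Prod>i=1..m. 1 - t i) (Abs_fps b)"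
  let ?I = "\<lambda>k. 1 / (real (n + 1) * real (n choose k))"
  have "((\<lambda>s::real. s ^ k * (1 - s) ^ (n - k)) has_integral ?I k) {0..1}" if "k \<in> {0..n}" for k
    using has_integral_power_mult_power_Beta[of k "n - k"] that by simp
  note integral = cube_integral_sum_prod[OF finite_atLeastAtMost this]
  \<comment> \<open>Cauchy product: the scalings contribute the \<open>k\<close>-th and
    \<open>(n - k)\<close>-th powers of the two products, which are regrouped variable by
    variable.\<close>
  have "?F t $ n = (\<Sum>k=0..n. a k * b (n - k) *
      of_real (\<Prod>i=1..m. t i ^ k * (1 - t i) ^ (n - k)))" for t
    by (simp add: fps_mult_nth fps_scale_arg_nth prod.distrib flip: prod_power_distrib)
      (simp add: mult_ac)
  then have "fps_cube_integral m ?F $ n = (\<Sum>k=0..n. a k * b (n - k) * of_real (?I k ^ m))"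
    by (simp only: fps_cube_integral_def fps_nth_Abs_fps integral)
  then have "(mu ^^ m) (fps_cube_integral m ?F) $ n =
      (\<Sum>k=0..n. a k * b (n - k) * (of_nat (Suc n) ^ m * of_real (?I k ^ m)))"
    by (simp add: mu_funpow_nth sum_distrib_left mult_ac del: of_nat_Suc)
  also have "\<dots> = (\<Sum>k=0..n. of_nat (n choose k) powi (- int m) * a k * b (n - k))"
  proof (rule sum.cong[OF refl])
    fix k
    \<comment> \<open>Here \<open>k\<close> is arbitrary: for \<open>k > n\<close> the binomial
      coefficient is 0 and both sides agree because division by 0 gives 0.\<close>
    have "of_nat (Suc n) ^ m * (of_real (?I k ^ m) :: 'a) = of_nat (n choose k) powi (- int m)"
      by (simp add: power_int_minus power_divide power_mult_distrib divide_simps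
          del: of_nat_Suc)
    then show "a k * b (n - k) * (of_nat (Suc n) ^ m * of_real (?I k ^ m)) =
        of_nat (n choose k) powi (- int m) * a k * b (n - k)"
      by (simp add: mult_ac)
  qed
  finally show "Abs_fps (\<lambda>n. \<Sum>k=0..n. of_nat (n choose k) powi (- int m) * a k * b (n - k)) $ n =
      (mu ^^ m) (fps_cube_integral m ?F) $ n"
    by simp
qed

end
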